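(* Let $n\ge 1$ and let $P_1(z)=a_nz^n+a_{n-1}z^{n-1}+\cdots+a_0$ and $P_0(z)=b_nz^n+b_{n-1}z^{n-1}+\cdots+b_0$ be non-constant polynomials with complex coefficients, $a_n\neq 0$, $b_n\neq 0$. Let $h_1$ and $h_0$ be entire functions, not identically zero, satisfying $\rho(h_1)<\deg P_1$ and $\rho(h_0)<\deg P_0$. Suppose that $P_1(z)-cP_0(z)$ is a constant for some real $c\geq 1$, and that $\rho(h_1)<\mu(h_0)\leq \frac{1}{2}$. Then every non-trivial solution $f$ of the differential equation $$f''+h_1(z)e^{P_1(z)}f'+h_0(z)e^{P_0(z)}f=0$$ is of infinite order.
   Context: All solutions of this equation are entire functions. For an entire function $g$, with $M(r,g)=\max_{|z|=r}|g(z)|$, the order is $\rho(g)=\limsup_{r\to\infty}\frac{\log^+\log^+ M(r,g)}{\log r}$ and the lower order is $\mu(g)=\liminf_{r\to\infty}\frac{\log^+\log^+ M(r,g)}{\log r}$. A solution is non-trivial if it is not identically zero; it has infinite order if $\rho(f)=\infty$. *)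

theory Defs
  imports "HOL-Complex_Analysis.Complex_Analysis" "HOL-Computational_Algebra.Polynomial"
begin

definition max_modulus :: "(complex \<Rightarrow> complex) \<Rightarrow> real \<Rightarrow> real" where
  "max_modulus g r = Sup ((\<lambda>z. norm (g z)) ` sphere 0 r)"

definition log_plus :: "real \<Rightarrow> real" where
  "log_plus x = (if x \<le> 1 then 0 else ln x)"

definition entire_order :: "(complex \<Rightarrow> complex) \<Rightarrow> ereal" where
  "entire_order g = Limsup at_top (\<lambda>r::real. ereal (log_plus (log_plus (max_modulus g r)) / ln r))"

definition entire_lower_order :: "(complex \<Rightarrow> complex) \<Rightarrow> ereal" where
  "entire_lower_order g = Liminf at_top (\<lambda>r::real. ereal (log_plus (log_plus (max_modulus g r)) / ln r))"

end

theory Submission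
  imports Defs "HOL-Real_Asymp.Real_Asymp"
begin

text \<open>
  Suppose that \<open>f\<close> has finite order. Dividing the equation by \<open>f\<close> expresses \<open>h0 * exp P0\<close> through
  \<open>f''/f\<close>, \<open>f'/f\<close> and \<open>h1 * exp P1\<close>. Around every point \<open>z0\<close> there is a circle, of radius at most a
  prescribed negative power of \<open>|z0|\<close>, on which the two quotients are bounded by a power of \<open>|z0|\<close>.
  If \<open>Re P0 z0 = 0\<close>, then both exponentials are bounded above and below on that circle, because
  \<open>Re P1\<close> and \<open>c * Re P0\<close> differ by a constant. So \<open>h0\<close> is essentially bounded by \<open>h1\<close> there and,
  by the maximum principle, at \<open>z0\<close>. The curves \<open>Re P0 = 0\<close> cut the plane into regions of asymptotic
  opening \<open>pi/n\<close> and \<open>h0\<close> has order less than \<open>n\<close>, so the Phragmen-Lindelof principle propagates the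
  bound to the whole plane. Hence the lower order of \<open>h0\<close> is at most the order of \<open>h1\<close>, a
  contradiction.
\<close>

subsection \<open>Order and growth\<close>

lemma norm_le_max_modulus:
  assumes "continuous_on UNIV g"
  shows "norm (g z) \<le> max_modulus g (norm z)"
proof -
  have "continuous_on (sphere 0 (norm z)) (\<lambda>z. norm (g z))"
    using assms by (intro continuous_intros) (auto intro: continuous_on_subset)
  then have "compact ((\<lambda>z. norm (g z)) ` sphere 0 (norm z))"
    by (intro compact_continuous_image) auto
  then have "bdd_above ((\<lambda>z. norm (g z)) ` sphere 0 (norm z))"
    by (intro bounded_imp_bdd_above compact_imp_bounded)
  then show ?thesis
    unfolding max_modulus_def by (intro cSup_upper) auto
qed

lemma max_modulus_le:
  assumes "r \<ge> 0" "\<And>z. norm z = r \<Longrightarrow> norm (g z) \<le> B"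
  shows "max_modulus g r \<le> B"
proof -
  have "complex_of_real r \<in> sphere 0 r"
    using assms(1) by simp
  then show ?thesis
    unfolding max_modulus_def using assms(2) by (intro cSup_least) auto
qed

lemma log_plus_nonneg: "log_plus x \<ge> 0"
  by (simp add: log_plus_def)

text \<open>With this equivalence a bound on the iterated \<open>log_plus\<close> unwinds to a
  double exponential and back, without separating the truncated range each time.\<close>

lemma log_plus_le_iff:
  assumes "y \<ge> 0"
  shows "log_plus x \<le> y \<longleftrightarrow> x \<le> exp y"
proof (cases "x \<le> 1")
  case True
  have "1 \<le> exp y" using assms by simp
  with True have "x \<le> exp y" by linarith
  with True assms show ?thesis by (simp add: log_plus_def)
next
  case False
  then show ?thesis using ln_le_cancel_iff[of x "exp y"] by (simp add: log_plus_def)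
qed

text \<open>Since \<open>s\<close> lies strictly above the limsup, the quotient of logarithms is
  below \<open>s\<close> at all large radii, so no extra epsilon appears in the exponent.\<close>

lemma exp_powr_bound_if_entire_order_less:
  assumes "g holomorphic_on UNIV" "entire_order g < ereal s"
  obtains R where "\<And>z. norm z \<ge> R \<Longrightarrow> norm (g z) \<le> exp (norm z powr s)"
proof -
  have "\<forall>\<^sub>F r in at_top. ereal (log_plus (log_plus (max_modulus g r)) / ln r) < ereal s"
    using assms(2) unfolding entire_order_def by (rule Limsup_lessD)
  then have "\<forall>\<^sub>F r in at_top. log_plus (log_plus (max_modulus g r)) / ln r < s \<and> r > 1"
    using eventually_gt_at_top[of "1::real"] by eventually_elim auto
  then obtain R where R: "\<And>r. r \<ge> R \<Longrightarrow> log_plus (log_plus (max_modulus g r)) / ln r < s \<and> r > 1"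
    by (auto simp: eventually_at_top_linorder)
  show thesis
  proof
    fix z :: complex assume "norm z \<ge> R"
    then have r: "log_plus (log_plus (max_modulus g (norm z))) / ln (norm z) < s" "norm z > 1"
      using R by auto
    then have *: "log_plus (log_plus (max_modulus g (norm z))) \<le> s * ln (norm z)"
      by (subst (asm) pos_divide_less_eq) (auto intro: ln_gt_zero)
    \<comment> \<open>Nonnegativity of this bound is what allows \<open>log_plus_le_iff\<close> to
      remove the outer \<open>log_plus\<close>.\<close>
    then have "s * ln (norm z) \<ge> 0"
      using log_plus_nonneg order_trans by blast
    then have "max_modulus g (norm z) \<le> exp (exp (s * ln (norm z)))"
      using * by (simp add: log_plus_le_iff)
    also have "exp (s * ln (norm z)) = norm z powr s"
      using r(2) by (auto simp: powr_def)
    finally show "norm (g z) \<le> exp (norm z powr s)"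
      using norm_le_max_modulus[of g z] assms(1) holomorphic_on_imp_continuous_on by fastforce
  qed
qed

text \<open>The bound holds on every large circle, so it even limits the limsup, and the liminf lies
  below that. In the final contradiction it is applied to \<open>h0\<close>.\<close>

lemma entire_lower_order_le:
  assumes "s \<ge> 0" "\<And>z. norm z \<ge> R \<Longrightarrow> norm (g z) \<le> exp (norm z powr s)"
  shows "entire_lower_order g \<le> ereal s"
proof -
  have "\<forall>\<^sub>F r in at_top. ereal (log_plus (log_plus (max_modulus g r)) / ln r) \<le> ereal s"
    using eventually_gt_at_top[of "1::real"] eventually_ge_at_top[of R]
  proof eventually_elim
    case (elim r)
    have "max_modulus g r \<le> exp (r powr s)"
      using elim assms(2) by (intro max_modulus_le) auto
    then have "log_plus (max_modulus g r) \<le> exp (s * ln r)"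
      using elim by (subst log_plus_le_iff) (auto simp: powr_def)
    then have "log_plus (log_plus (max_modulus g r)) \<le> s * ln r"
      using elim assms(1) by (subst log_plus_le_iff) auto
    with elim show ?case by (simp add: pos_divide_le_eq)
  qed
  then have "Limsup at_top (\<lambda>r. ereal (log_plus (log_plus (max_modulus g r)) / ln r)) \<le> ereal s"
    by (rule Limsup_bounded)
  then show ?thesis
    unfolding entire_lower_order_def
    using Liminf_le_Limsup[OF trivial_limit_at_top_linorder] order_trans by blast
qed

lemma entire_order_nonneg: "entire_order g \<ge> 0"
proof -
  have "\<forall>\<^sub>F r in at_top. ereal 0 \<le> ereal (log_plus (log_plus (max_modulus g r)) / ln r)"
    using eventually_gt_at_top[of "1::real"]
    by eventually_elim (auto intro!: divide_nonneg_nonneg log_plus_nonneg)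
  then have "Limsup at_top (\<lambda>r::real. ereal 0) \<le> entire_order g"
    unfolding entire_order_def by (rule Limsup_mono)
  then show ?thesis by (simp add: Limsup_const zero_ereal_def)
qed

text \<open>Finite order is put into a form with a natural exponent and no exceptional disc:
  compactness handles small \<open>z\<close>, and \<open>1 + norm z\<close> keeps the bound away
  from 0.\<close>

lemma exp_power_bound_if_entire_order_finite:
  assumes "g holomorphic_on UNIV" "entire_order g \<noteq> \<infinity>"
  obtains C :: real and K :: nat
    where "C > 0" "\<And>z. norm (g z) \<le> exp (C * (1 + norm z) ^ K)"
proof -
  obtain K :: nat where K: "entire_order g < ereal (real K)"
    using assms(2) less_PInf_Ex_of_nat[of "entire_order g"] by auto
  obtain R0 where R0: "\<And>z. norm z \<ge> R0 \<Longrightarrow> norm (g z) \<le> exp (norm z powr real K)"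
    using exp_powr_bound_if_entire_order_less[OF assms(1) K] by blast
  define R where "R = max 1 R0"
  have "continuous_on (cball 0 R) g"
    using assms(1) holomorphic_on_imp_continuous_on continuous_on_subset by blast
  then have "bounded (g ` cball 0 R)"
    by (intro compact_imp_bounded compact_continuous_image) auto
  then obtain B where "\<forall>w\<in>g ` cball 0 R. norm w \<le> B"
    unfolding bounded_iff by blast
  then have B: "norm (g z) \<le> B" if "norm z \<le> R" for z
    using that by auto
  define C where "C = max 1 B"
  show thesis
  proof
    show "C > 0" by (simp add: C_def)
    fix z :: complex
    have one: "1 \<le> (1 + norm z) ^ K" by simp
    show "norm (g z) \<le> exp (C * (1 + norm z) ^ K)"
    proof (cases "norm z \<le> R")
      case True
      have "norm (g z) \<le> C" using B[OF True] by (simp add: C_def)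
      also have "C \<le> C * (1 + norm z) ^ K"
        using mult_left_mono[OF one, of C] by (simp add: C_def)
      also have "\<dots> \<le> exp (C * (1 + norm z) ^ K)"
        using exp_ge_add_one_self[of "C * (1 + norm z) ^ K"] by linarith
      finally show ?thesis .
    next
      case False
      then have "norm z > 0" "norm z \<ge> R0" by (auto simp: R_def)
      have "norm (g z) \<le> exp (norm z ^ K)"
        using R0[OF \<open>norm z \<ge> R0\<close>] \<open>norm z > 0\<close> by (simp add: powr_realpow)
      also have "norm z ^ K \<le> 1 * (1 + norm z) ^ K"
        by (simp add: power_mono)
      also have "\<dots> \<le> C * (1 + norm z) ^ K"
        by (intro mult_right_mono) (auto simp: C_def)
      finally show ?thesis by simp
    qed
  qed
qed

subsection \<open>Logarithmic derivatives of entire functions of finite order\<close>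

text \<open>On the circle of radius \<open>6 * R\<close> every factor has modulus at least
  \<open>norm (z / a) - 1 \<ge> 3 - 1 = 2\<close>, so the cofactor is small there, and the maximum
  principle carries this inside. At \<open>z = 0\<close> it becomes a Jensen-type bound on the
  number of factors.\<close>

lemma norm_cofactor_le:
  fixes as :: "complex list"
  assumes g: "g holomorphic_on UNIV" and R: "R > 0"
    and as: "\<And>a. a \<in> set as \<Longrightarrow> a \<noteq> 0 \<and> norm a \<le> 2 * R"
    and M: "\<And>z. norm z = 6 * R \<Longrightarrow> norm ((\<Prod>a\<leftarrow>as. 1 - z / a) * g z) \<le> M"
    and z: "norm z \<le> 6 * R"
  shows "2 ^ length as * norm (g z) \<le> M"
proof -
  have prod_ge: "2 ^ length xs \<le> norm (\<Prod>a\<leftarrow>xs. 1 - w / a)"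
    if "norm w = 6 * R" "set xs \<subseteq> set as" for w xs
    using that(2)
  proof (induction xs)
    case (Cons a xs)
    then have a: "a \<noteq> 0" "norm a \<le> 2 * R" using as by auto
    then have "3 \<le> norm (w / a)" using that(1) R by (simp add: norm_divide field_simps)
    then have "2 \<le> norm (1 - w / a)"
      using norm_triangle_ineq2[of "w / a" 1] by (simp add: norm_minus_commute)
    with Cons show ?case by (auto simp: norm_mult intro!: mult_mono)
  qed simp
  have "norm (2 ^ length as * g z) \<le> M"
  proof (rule maximum_modulus_frontier[where f = "\<lambda>z. 2 ^ length as * g z"])
    show "(\<lambda>z. 2 ^ length as * g z) holomorphic_on interior (cball 0 (6 * R))"
      by (intro holomorphic_intros holomorphic_on_subset[OF g]) auto
    show "continuous_on (closure (cball 0 (6 * R))) (\<lambda>z. 2 ^ length as * g z)"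
      by (intro continuous_intros holomorphic_on_imp_continuous_on holomorphic_on_subset[OF g]) auto
    fix w :: complex assume "w \<in> frontier (cball 0 (6 * R))"
    then have w: "norm w = 6 * R" by simp
    have "norm (2 ^ length as * g w) \<le> norm (\<Prod>a\<leftarrow>as. 1 - w / a) * norm (g w)"
      using prod_ge[OF w order_refl] by (simp add: norm_mult norm_power mult_right_mono)
    also have "\<dots> \<le> M" using M[OF w] by (simp add: norm_mult)
    finally show "norm (2 ^ length as * g w) \<le> M" .
  qed (use z in auto)
  then show ?thesis by (simp add: norm_mult norm_power)
qed

text \<open>The list \<open>as\<close> collects the zeros in the closed disc of radius
  \<open>2 * R\<close> with multiplicity. Each factor equals 1 at the origin, so
  \<open>g 0 = f 0\<close>, which ties the number of factors to the growth of
  \<open>f\<close>.\<close>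

lemma zero_free_factorization:
  fixes f :: "complex \<Rightarrow> complex"
  assumes f: "f holomorphic_on UNIV" and f0: "f 0 \<noteq> 0" and R: "R > 0"
  shows "\<exists>g as. g holomorphic_on UNIV \<and> (\<forall>a\<in>set as. a \<noteq> 0 \<and> norm a \<le> 2 * R) \<and>
    (\<forall>z. f z = (\<Prod>a\<leftarrow>as. 1 - z / a) * g z) \<and> (\<forall>z. norm z \<le> 2 * R \<longrightarrow> g z \<noteq> 0)"
proof -
  define fac where "fac as g \<longleftrightarrow> g holomorphic_on UNIV \<and>
      (\<forall>a\<in>set as. a \<noteq> 0 \<and> norm a \<le> 2 * R) \<and> (\<forall>z. f z = (\<Prod>a\<leftarrow>as. 1 - z / a) * g z)"
    for as :: "complex list" and g
  have "bounded (f ` sphere 0 (6 * R))"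
    by (intro compact_imp_bounded compact_continuous_image
        continuous_on_subset[OF holomorphic_on_imp_continuous_on[OF f]]) auto
  then obtain M where "\<forall>w\<in>f ` sphere 0 (6 * R). norm w \<le> M"
    unfolding bounded_iff by blast
  then have M: "norm (f z) \<le> M" if "norm z = 6 * R" for z
    using that by auto
  obtain B :: nat where B: "M / norm (f 0) < 2 ^ B"
    using real_arch_pow[of 2 "M / norm (f 0)"] by auto
  \<comment> \<open>The number of factors is bounded, so a factorization of maximal length exists; its cofactor has
    no zero left to split off.\<close>
  have len: "length as \<le> B" if "fac as g" for as g
  proof -
    have "f 0 = g 0"
    proof -
      have "(\<Prod>a\<leftarrow>xs. 1 - 0 / a) = (1::complex)" for xs
        by (induction xs) auto
      then show ?thesis using that by (simp add: fac_def)
    qed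
    have "2 ^ length as * norm (g 0) \<le> M"
    proof (rule norm_cofactor_le[where g = g and z = 0, OF _ R])
      show "norm ((\<Prod>a\<leftarrow>as. 1 - z / a) * g z) \<le> M" if "norm z = 6 * R" for z
        using \<open>fac as g\<close> M[OF that] unfolding fac_def by metis
    qed (use that R in \<open>auto simp: fac_def\<close>)
    then have "2 ^ length as \<le> M / norm (f 0)"
      using f0 \<open>f 0 = g 0\<close> by (simp add: field_simps)
    also have "\<dots> < 2 ^ B" by (rule B)
    finally show ?thesis by simp
  qed
  have "\<exists>g. fac [] g" using f by (auto simp: fac_def)
  then have "\<exists>as. (\<exists>g. fac as g) \<and> (\<forall>bs. (\<exists>g. fac bs g) \<longrightarrow> length bs \<le> length as)"
    using len by (intro ex_has_greatest_nat[where b = "Suc B"]) (auto intro: le_imp_less_Suc)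
  then obtain as g where g: "fac as g" and mx: "\<And>bs h. fac bs h \<Longrightarrow> length bs \<le> length as"
    by blast
  have nz: "g z \<noteq> 0" if "norm z \<le> 2 * R" for z
  proof
    assume gz: "g z = 0"
    then have "f z = 0" using g by (simp add: fac_def)
    then have "z \<noteq> 0" using f0 by auto
    \<comment> \<open>The divided difference of \<open>g\<close> at its zero \<open>z\<close>, with
      the removable singularity filled in by the derivative; the factor \<open>- z\<close> matches
      the normalization \<open>1 - w / z\<close>.\<close>
    define h where "h = (\<lambda>w. - z * (if w = z then deriv g z else (g w - g z) / (w - z)))"
    have "h holomorphic_on UNIV"
      unfolding h_def using g by (intro holomorphic_intros pole_lemma_open) (auto simp: fac_def)
    moreover have "g w = (1 - w / z) * h w" for w
      using gz \<open>z \<noteq> 0\<close> by (cases "w = z") (auto simp: h_def field_simps)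
    ultimately have "fac (z # as) h"
      using g \<open>z \<noteq> 0\<close> that by (auto simp: fac_def)
    from mx[OF this] show False by simp
  qed
  show ?thesis
    using g nz by (intro exI[of _ g] exI[of _ as]) (auto simp: fac_def)
qed

text \<open>Writing the derivative as the product times its logarithmic derivative leaves only
  simple fractions after division by the function.\<close>

lemma has_field_derivative_prod_list_linear_factors:
  fixes as :: "complex list"
  assumes "0 \<notin> set as" "z \<notin> set as"
  shows "((\<lambda>z. \<Prod>a\<leftarrow>as. 1 - z / a) has_field_derivative
           (\<Prod>a\<leftarrow>as. 1 - z / a) * (\<Sum>a\<leftarrow>as. 1 / (z - a))) (at z)"
  using assms
proof (induction as)
  case (Cons a as)
  then have IH: "((\<lambda>z. \<Prod>a\<leftarrow>as. 1 - z / a) has_field_derivative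
           (\<Prod>a\<leftarrow>as. 1 - z / a) * (\<Sum>a\<leftarrow>as. 1 / (z - a))) (at z)" by simp
  have nz: "a \<noteq> 0" "z - a \<noteq> 0" using Cons.prems by auto
  then have eq: "- 1 / a = (1 - z / a) * (1 / (z - a))"
    by (simp add: divide_simps)
  have "((\<lambda>z. 1 - z / a) has_field_derivative (- 1 / a)) (at z)"
    using nz by (auto intro!: derivative_eq_intros)
  then have "((\<lambda>z. 1 - z / a) has_field_derivative (1 - z / a) * (1 / (z - a))) (at z)"
    unfolding eq .
  note D = DERIV_mult[OF this IH]
  have "X * Y * P + P * S * X = X * P * (Y + S)" for X Y P S :: complex
    by (simp add: algebra_simps)
  from DERIV_cong[OF D this] show ?case
    by simp
qed simp

section \<open>Bounds for logarithmic derivatives\<close>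

text \<open>The map sending \<open>w\<close> to \<open>w / (2 * A - w)\<close> takes the half-plane
  \<open>Re w < A\<close> into the unit disc and fixes 0, so the Schwarz lemma applies to its
  composition with \<open>f\<close>, rescaled to the unit disc.\<close>

lemma Borel_Caratheodory:
  fixes f :: "complex \<Rightarrow> complex"
  assumes f: "f holomorphic_on ball 0 R" and f0: "f 0 = 0" and A: "A > 0"
    and Re: "\<And>z. norm z < R \<Longrightarrow> Re (f z) < A" and z: "norm z < R"
  shows "norm (f z) \<le> 2 * A * norm z / (R - norm z)"
proof -
  have R: "R > 0" using z norm_ge_zero[of z] by linarith
  define \<phi> where "\<phi> w = f (R * w) / (2 * A - f (R * w))" for w :: complex
  have lt: "norm (f w) < norm (2 * A - f w)" if "norm w < R" for w
  proof -
    have "(norm (2 * A - f w))\<^sup>2 - (norm (f w))\<^sup>2 = 4 * A * (A - Re (f w))"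
      unfolding cmod_power2 by (simp add: power2_eq_square algebra_simps)
    also have "\<dots> > 0" using Re[OF that] A by simp
    finally show ?thesis by (simp add: power2_less_imp_less)
  qed
  have ne: "2 * complex_of_real A - f w \<noteq> 0" if "norm w < R" for w
    using lt[OF that] by (metis norm_not_less_zero norm_zero of_real_mult of_real_numeral)
  have in_ball: "norm (R * w) < R" if "norm w < 1" for w :: complex
    using that R by (simp add: norm_mult)
  have "f \<circ> (\<lambda>w. R * w) holomorphic_on ball 0 1"
  proof (rule holomorphic_on_compose_gen[OF _ f])
    show "(\<lambda>w. complex_of_real R * w) holomorphic_on ball 0 1"
      by (intro holomorphic_intros)
    show "(\<lambda>w. complex_of_real R * w) ` ball 0 1 \<subseteq> ball 0 R"
      using in_ball by auto
  qed
  then have "(\<lambda>w. f (R * w)) holomorphic_on ball 0 1"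
    by (simp add: o_def)
  then have "\<phi> holomorphic_on ball 0 1"
    unfolding \<phi>_def using ne in_ball by (intro holomorphic_on_divide holomorphic_on_diff) auto
  moreover have "\<phi> 0 = 0" by (simp add: \<phi>_def f0)
  moreover have "norm (\<phi> w) < 1" if "norm w < 1" for w
  proof -
    have "norm (f (R * w)) < norm (2 * A - f (R * w))"
      by (rule lt[OF in_ball[OF that]])
    moreover from this have "0 < norm (2 * A - f (R * w))"
      by (rule le_less_trans[OF norm_ge_zero])
    ultimately show ?thesis by (simp add: \<phi>_def norm_divide)
  qed
  ultimately have "norm (\<phi> (z / R)) \<le> norm (z / R)"
    using z R by (intro Schwarz_Lemma(1)) (auto simp: norm_divide)
  then have "norm (f z) / norm (2 * A - f z) \<le> norm z / R"
    using R by (simp add: \<phi>_def norm_divide)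
  moreover have pos: "0 < norm (2 * A - f z)"
    using lt[OF z] le_less_trans[OF norm_ge_zero] by blast
  ultimately have "norm (f z) * R \<le> norm z * norm (2 * A - f z)"
    using R by (simp add: field_simps)
  also have "\<dots> \<le> norm z * (2 * A + norm (f z))"
    using norm_triangle_ineq4[of "2 * A" "f z"] A by (intro mult_left_mono) auto
  finally show ?thesis
    using z by (simp add: field_simps)
qed

text \<open>A zero-free function has a holomorphic logarithm on the disc. Normalized to vanish at 0,
  its real part is below \<open>A\<close>, so Borel-Caratheodory bounds it by \<open>6 * A\<close>
  up to radius \<open>3 / 2 * R\<close>; Cauchy's estimate on circles of radius \<open>R / 2\<close>
  then bounds its derivative, which is \<open>g' / g\<close>.\<close>

lemma norm_logderiv_le_if_zero_free:
  assumes g: "g holomorphic_on ball 0 (2 * R)" and nz: "\<And>z. norm z < 2 * R \<Longrightarrow> g z \<noteq> 0"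
    and A: "A > 0" and le: "\<And>z. norm z < 2 * R \<Longrightarrow> norm (g z) < norm (g 0) * exp A"
    and R: "R > 0" and z: "norm z \<le> R"
  shows "norm (deriv g z / g z) \<le> 12 * A / R"
proof -
  obtain G where G: "G holomorphic_on ball 0 (2 * R)" "\<And>w. w \<in> ball 0 (2 * R) \<Longrightarrow> exp (G w) = g w"
    using holomorphic_logarithm_exists[of "ball 0 (2 * R)" g 0] g nz R by auto
  define H where "H w = G w - G 0" for w
  have H: "H holomorphic_on ball 0 (2 * R)"
    unfolding H_def by (intro holomorphic_intros G)
  have g_eq: "g w = g 0 * exp (H w)" if "norm w < 2 * R" for w
    using G(2)[of w] G(2)[of 0] that R nz[of 0] by (simp add: H_def exp_diff)
  have Hle: "norm (H w) \<le> 6 * A" if "norm w \<le> 3 / 2 * R" for w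
  proof -
    have "Re (H v) < A" if "norm v < 2 * R" for v
    proof -
      have "norm (g 0) * exp (Re (H v)) < norm (g 0) * exp A"
        using le[OF that] g_eq[OF that] by (metis norm_exp_eq_Re norm_mult)
      then show ?thesis using nz[of 0] R by simp
    qed
    moreover have "H 0 = 0" by (simp add: H_def)
    ultimately have "norm (H w) \<le> 2 * A * norm w / (2 * R - norm w)"
      using H A that R by (intro Borel_Caratheodory) auto
    also have "\<dots> \<le> 2 * A * (3 / 2 * R) / (2 * R - 3 / 2 * R)"
      using that A R by (intro frac_le mult_mono) auto
    also have "\<dots> = 6 * A" using R by (simp add: field_simps)
    finally show ?thesis .
  qed
  have sub: "norm w \<le> 3 / 2 * R" if "norm (z - w) \<le> R / 2" for w
    using norm_triangle_ineq2[of w z] that z by (simp add: norm_minus_commute)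
  have cb: "cball z (R / 2) \<subseteq> ball 0 (2 * R)"
    using sub R by (force simp: dist_norm)
  have "norm ((deriv ^^ 1) H z) \<le> fact 1 * (6 * A) / (R / 2) ^ 1"
  proof (rule Cauchy_inequality)
    show "H holomorphic_on ball z (R / 2)"
      using H cb by (meson ball_subset_cball holomorphic_on_subset)
    show "continuous_on (cball z (R / 2)) H"
      using H cb by (meson holomorphic_on_imp_continuous_on continuous_on_subset)
  qed (use R sub Hle in auto)
  then have H': "norm (deriv H z) \<le> 12 * A / R" by (simp add: field_simps)
  have zb: "z \<in> ball 0 (2 * R)" using z R by auto
  have "(H has_field_derivative deriv H z) (at z)"
    by (rule holomorphic_derivI[OF H _ zb]) auto
  then have "((\<lambda>w. g 0 * exp (H w)) has_field_derivative g 0 * exp (H z) * deriv H z) (at z)"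
    by (auto intro!: derivative_eq_intros)
  moreover have "\<forall>\<^sub>F w in nhds z. g 0 * exp (H w) = g w"
    using zb g_eq by (intro eventually_nhds_in_open[THEN eventually_mono, of "ball 0 (2*R)"]) auto
  ultimately have "(g has_field_derivative g 0 * exp (H z) * deriv H z) (at z)"
    by (subst (asm) DERIV_cong_ev[OF refl _ refl])
  then have "deriv g z = g z * deriv H z"
    using g_eq[of z] zb by (auto dest!: DERIV_imp_deriv)
  then show ?thesis using H' nz[of z] zb by simp
qed

text \<open>After factorization, \<open>f' / f\<close> is a sum of terms \<open>1 / (z - a)\<close>
  plus the logarithmic derivative of a zero-free cofactor. The growth on the circle of radius
  \<open>6 * R\<close> controls both the number of terms and the cofactor; \<open>as\<close> is
  independent of \<open>z\<close> and \<open>d\<close>.\<close>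

lemma norm_logderiv_le:
  fixes f :: "complex \<Rightarrow> complex"
  assumes f: "f holomorphic_on UNIV" and f0: "f 0 \<noteq> 0" and R: "R > 0" and A: "A > 0"
    and le: "\<And>z. norm z = 6 * R \<Longrightarrow> norm (f z) < norm (f 0) * exp A"
  obtains as where "real (length as) \<le> 2 * A"
    "\<And>z d. norm z \<le> R \<Longrightarrow> d > 0 \<Longrightarrow> (\<And>a. a \<in> set as \<Longrightarrow> d \<le> norm (z - a)) \<Longrightarrow>
       f z \<noteq> 0 \<and> norm (deriv f z / f z) \<le> length as / d + 12 * A / R"
proof -
  obtain g as where fac: "g holomorphic_on UNIV \<and> (\<forall>a\<in>set as. a \<noteq> 0 \<and> norm a \<le> 2 * R) \<and>
      (\<forall>z. f z = (\<Prod>a\<leftarrow>as. 1 - z / a) * g z) \<and> (\<forall>z. norm z \<le> 2 * R \<longrightarrow> g z \<noteq> 0)"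
    using zero_free_factorization[OF f f0 R] by (elim exE)
  then have g: "g holomorphic_on UNIV" by blast
  have as: "a \<noteq> 0 \<and> norm a \<le> 2 * R" if "a \<in> set as" for a using fac that by blast
  have fg: "f z = (\<Prod>a\<leftarrow>as. 1 - z / a) * g z" for z using fac by blast
  have nz: "g z \<noteq> 0" if "norm z \<le> 2 * R" for z using fac that by blast
  have "(\<Prod>a\<leftarrow>xs. 1 - 0 / a) = (1::complex)" for xs
    by (induction xs) auto
  then have g0: "g 0 = f 0" using fg[of 0] by simp
  \<comment> \<open>Compactness turns the strict pointwise bound into one number \<open>M\<close>
    strictly below \<open>norm (f 0) * exp A\<close>; the strictness is passed on to the
    cofactor.\<close>
  obtain M where M: "M < norm (f 0) * exp A" "\<And>z. norm z = 6 * R \<Longrightarrow> norm (f z) \<le> M"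
  proof -
    have "\<exists>x\<in>sphere 0 (6 * R). \<forall>y\<in>sphere 0 (6 * R). norm (f y) \<le> norm (f x)"
      using R by (intro continuous_attains_sup continuous_intros
          continuous_on_subset[OF holomorphic_on_imp_continuous_on[OF f]]) auto
    then obtain x where "norm x = 6 * R" "\<forall>y\<in>sphere 0 (6 * R). norm (f y) \<le> norm (f x)"
      by auto
    then show thesis using that[of "norm (f x)"] le[of x] by simp
  qed
  have cof: "2 ^ length as * norm (g z) \<le> M" if "norm z \<le> 6 * R" for z
    using M(2) fg by (intro norm_cofactor_le[OF g R as _ that]) auto
  have g_le: "norm (g z) < norm (g 0) * exp A" if "norm z \<le> 6 * R" for z
  proof -
    have "1 * norm (g z) \<le> 2 ^ length as * norm (g z)"
      by (intro mult_right_mono) auto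
    with cof[OF that] M(1) show ?thesis by (simp add: g0)
  qed
  show thesis
  proof
    \<comment> \<open>The cofactor bound at the origin gives \<open>length as * ln 2 < A\<close>,
      and \<open>ln 2 \<ge> 1 / 2\<close> yields the stated count.\<close>
    have "2 ^ length as * norm (f 0) < exp A * norm (f 0)"
      using cof[of 0] R M(1) g0 by (simp add: mult.commute)
    then have "2 ^ length as < exp A" using f0 by simp
    then have "ln (2 ^ length as) < A" by (metis ln_exp exp_gt_zero ln_less_cancel_iff zero_less_power zero_less_numeral)
    then have "length as * ln 2 < A" by (simp add: ln_realpow)
    moreover have "length as * (1 / 2) \<le> length as * ln (2::real)"
      using ln2_ge_two_thirds by (intro mult_left_mono) auto
    ultimately show "real (length as) \<le> 2 * A" by linarith
  next
    fix z :: complex and d :: real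
    assume z: "norm z \<le> R" and d: "d > 0" "\<And>a. a \<in> set as \<Longrightarrow> d \<le> norm (z - a)"
    have notin: "z \<notin> set as" using d by fastforce
    have zero: "0 \<notin> set as" using as by auto
    let ?P = "\<lambda>z. \<Prod>a\<leftarrow>as. 1 - z / a"
    have P: "?P z \<noteq> 0"
    proof
      assume "?P z = 0"
      then obtain a where "a \<in> set as" "1 - z / a = 0"
        by (auto simp: prod_list_zero_iff)
      then have "z = a" using as by (auto simp: field_simps)
      with \<open>a \<in> set as\<close> notin show False by simp
    qed
    have gz: "g z \<noteq> 0" using nz z R by auto
    have "(g has_field_derivative deriv g z) (at z)"
      by (rule holomorphic_derivI[OF g]) auto
    from DERIV_mult[OF has_field_derivative_prod_list_linear_factors[OF zero notin] this]
    have "(f has_field_derivative ?P z * (\<Sum>a\<leftarrow>as. 1 / (z - a)) * g z + deriv g z * ?P z) (at z)"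
      unfolding fg[abs_def] .
    then have "deriv f z = ?P z * (\<Sum>a\<leftarrow>as. 1 / (z - a)) * g z + deriv g z * ?P z"
      by (rule DERIV_imp_deriv)
    then have eq: "deriv f z / f z = (\<Sum>a\<leftarrow>as. 1 / (z - a)) + deriv g z / g z"
      using P gz unfolding fg[of z] by (simp add: field_simps)
    have sum_le: "norm (\<Sum>a\<leftarrow>xs. 1 / (z - a)) \<le> length xs / d" if "set xs \<subseteq> set as" for xs
      using that
    proof (induction xs)
      case (Cons a xs)
      have "norm (1 / (z - a)) \<le> 1 / d"
        using d(1) d(2)[of a] Cons.prems by (simp add: norm_divide frac_le)
      then show ?case
        using Cons norm_triangle_ineq[of "1 / (z - a)" "\<Sum>a\<leftarrow>xs. 1 / (z - a)"]
        by (simp add: add_divide_distrib)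
    qed simp
    have "norm (deriv g z / g z) \<le> 12 * A / R"
      using nz g_le R A z
      by (intro norm_logderiv_le_if_zero_free holomorphic_on_subset[OF g]) auto
    then have "norm (deriv f z / f z) \<le> length as / d + 12 * A / R"
      unfolding eq using sum_le[OF order_refl] norm_triangle_ineq
      by (meson add_mono order_trans)
    with P gz show "f z \<noteq> 0 \<and> norm (deriv f z / f z) \<le> length as / d + 12 * A / R"
      unfolding fg[of z] by simp
  qed
qed

section \<open>Small circles away from the zeros\<close>

text \<open>By the pigeonhole principle: cut the interval from 0 to \<open>\<delta>\<close> into
  \<open>N + 1\<close> equal pieces. A point can come closer than half a piece to at most one of the
  midpoints, so \<open>N\<close> points cannot spoil all of them.\<close>

lemma exists_radius_avoiding:
  fixes X :: "real set"
  assumes X: "finite X" "card X \<le> N" and \<delta>: "\<delta> > 0"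
  obtains s where "0 < s" "s \<le> \<delta>" "\<And>x. x \<in> X \<Longrightarrow> \<delta> / (2 * (real N + 1)) \<le> \<bar>x - s\<bar>"
proof (rule ccontr)
  assume no: "\<not> thesis"
  note found = that
  define \<eta> where "\<eta> = \<delta> / (2 * (real N + 1))"
  have \<eta>: "\<eta> > 0" "\<delta> = \<eta> * (2 * (real N + 1))" using \<delta> by (auto simp: \<eta>_def)
  define s where "s j = \<eta> * (2 * real j + 1)" for j :: nat
  have "\<exists>x\<in>X. \<bar>x - s j\<bar> < \<eta>" if "j \<le> N" for j
  proof -
    have "0 < s j" "s j \<le> \<delta>"
      using \<eta>(1) that unfolding s_def by (auto simp: \<eta>(2))
    then show ?thesis
      using no found[of "s j"] unfolding \<eta>_def[symmetric] by (meson not_le)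
  qed
  then obtain x where x: "\<And>j. j \<le> N \<Longrightarrow> x j \<in> X \<and> \<bar>x j - s j\<bar> < \<eta>" by metis
  have "inj_on x {..N}"
  proof (rule inj_onI)
    fix i j assume ij: "i \<in> {..N}" "j \<in> {..N}" "x i = x j"
    then have "\<bar>x i - s i\<bar> < \<eta>" "\<bar>x i - s j\<bar> < \<eta>" using x[of i] x[of j] by auto
    then have "\<bar>s i - s j\<bar> < 2 * \<eta>" by linarith
    moreover have "s i - s j = 2 * \<eta> * (real i - real j)"
      by (simp add: s_def algebra_simps)
    ultimately have "\<bar>real i - real j\<bar> < 1" using \<eta>(1) by (simp add: abs_mult)
    then show "i = j" by linarith
  qed
  then have "card {..N} \<le> card X"
    using x X(1) by (intro card_inj_on_le) auto
  then show False using X(2) by simp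
qed

text \<open>The number of relevant zeros is polynomial in \<open>1 + norm z0\<close>, so some small
  radius keeps the circle away from all of them by an inverse polynomial amount. The second quotient
  follows from \<open>f'' / f = v' + v^2\<close> with \<open>v = f' / f\<close> and Cauchy's
  estimate for \<open>v\<close>.\<close>

lemma logderiv_bounds_on_small_circle_0:
  fixes f :: "complex \<Rightarrow> complex" and m K :: nat
  assumes f: "f holomorphic_on UNIV" and f0: "f 0 \<noteq> 0" and C: "C > 0"
    and growth: "\<And>z. norm (f z) \<le> exp (C * (1 + norm z) ^ K)"
  shows "\<exists>D>0. \<exists>L::nat. \<forall>z0. \<exists>s>0. s * (1 + norm z0) ^ m \<le> 1 \<and>
    (\<forall>z. norm (z - z0) = s \<longrightarrow> f z \<noteq> 0 \<and> norm (deriv f z / f z) \<le> D * (1 + norm z0) ^ L \<and>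
       norm (deriv (deriv f) z / f z) \<le> D * (1 + norm z0) ^ L)"
proof -
  \<comment> \<open>With \<open>t = 1 + norm z0\<close>: \<open>c0\<close> strictly exceeds the
    absolute value of \<open>ln (norm (f 0))\<close>, and 13 comes from
    \<open>1 + 6 * (norm z0 + 2) \<le> 13 * t\<close>. \<open>D1\<close> and \<open>U1\<close> are
    the coefficients in the polynomial bounds for \<open>1 / d\<close> and \<open>U\<close> below.
    \<open>D\<close> adds up the coefficients for \<open>U\<close>, \<open>U / d\<close> and the
    square of \<open>U\<close>; that square determines \<open>L\<close>.\<close>
  define c0 where "c0 = \<bar>ln (norm (f 0))\<bar> + 1"
  define A1 where "A1 = C * 13 ^ K + c0"
  define D1 where "D1 = 4 * (2 * A1 + 1)"
  define U1 where "U1 = 2 * A1 * D1 + 12 * A1"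
  define D where "D = U1 + (U1 * D1 + U1\<^sup>2)"
  define L where "L = 4 * K + 2 * m"
  have A1: "A1 > 0" using C by (simp add: A1_def c0_def add_pos_pos)
  have D1: "D1 > 0" using A1 by (simp add: D1_def)
  have U1: "U1 > 0" using A1 D1 by (simp add: U1_def add_pos_pos)
  have D: "D > 0" using U1 D1 by (simp add: D_def add_pos_pos)
  have "\<exists>s>0. s * (1 + norm z0) ^ m \<le> 1 \<and>
    (\<forall>z. norm (z - z0) = s \<longrightarrow> f z \<noteq> 0 \<and> norm (deriv f z / f z) \<le> D * (1 + norm z0) ^ L \<and>
       norm (deriv (deriv f) z / f z) \<le> D * (1 + norm z0) ^ L)" for z0
  proof -
    define t where "t = 1 + norm z0"
    \<comment> \<open>The margin 2 accommodates a circle of radius at most 1 around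
      \<open>z0\<close> together with discs of radius at most 1 around its points.\<close>
    define R where "R = norm z0 + 2"
    define A where "A = A1 * t ^ K"
    have t: "t \<ge> 1" by (simp add: t_def)
    have tK: "t ^ K \<ge> 1" using t by simp
    have R: "R \<ge> 1" "R > 0" by (auto simp: R_def intro: add_nonneg_pos)
    have A: "A > 0" using A1 t by (simp add: A_def)
    have le: "norm (f z) < norm (f 0) * exp A" if "norm z = 6 * R" for z
    proof -
      have "1 + norm z \<le> 13 * t" unfolding that R_def t_def by simp
      then have "C * (1 + norm z) ^ K \<le> C * (13 * t) ^ K"
        using C by (intro mult_left_mono power_mono) (auto intro: add_nonneg_nonneg)
      also have "\<dots> = A - c0 * t ^ K"
        by (simp add: A_def A1_def power_mult_distrib algebra_simps)
      also have "\<dots> \<le> A - c0"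
        using mult_left_mono[OF tK, of c0] by (simp add: c0_def)
      also have "\<dots> < A + ln (norm (f 0))" by (simp add: c0_def abs_if)
      finally have "exp (C * (1 + norm z) ^ K) < exp (A + ln (norm (f 0)))" by simp
      also have "\<dots> = norm (f 0) * exp A" using f0 by (simp add: exp_add)
      finally show ?thesis using growth[of z] by linarith
    qed
    obtain as where N: "real (length as) \<le> 2 * A"
      and u: "\<And>z d. norm z \<le> R \<Longrightarrow> d > 0 \<Longrightarrow> (\<And>a. a \<in> set as \<Longrightarrow> d \<le> norm (z - a)) \<Longrightarrow>
       f z \<noteq> 0 \<and> norm (deriv f z / f z) \<le> length as / d + 12 * A / R"
      using norm_logderiv_le[OF f f0 R(2) A le] by metis
    define N where "N = length as"
    define \<delta> where "\<delta> = 1 / t ^ m"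
    have \<delta>: "\<delta> > 0" "\<delta> \<le> 1" "\<delta> * t ^ m = 1" using t by (auto simp: \<delta>_def)
    have "card ((\<lambda>a. norm (a - z0)) ` set as) \<le> N"
      unfolding N_def by (meson List.finite_set card_image_le card_length order_trans)
    then obtain s where s: "0 < s" "s \<le> \<delta>"
      "\<And>x. x \<in> (\<lambda>a. norm (a - z0)) ` set as \<Longrightarrow> \<delta> / (2 * (real N + 1)) \<le> \<bar>x - s\<bar>"
      using exists_radius_avoiding[of "(\<lambda>a. norm (a - z0)) ` set as" N \<delta>] \<delta> by blast
    \<comment> \<open>Half the clearance between the circle and the points of \<open>as\<close>:
      discs of radius \<open>d\<close> centred on the circle still keep distance \<open>d\<close>
      from these points.\<close>
    define d where "d = \<delta> / (4 * (real N + 1))"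
    have two_d: "2 * d = \<delta> / (2 * (real N + 1))" by (simp add: d_def field_simps)
    have d: "d > 0" using \<delta> by (simp add: d_def)
    have "d \<le> 1 / 1" unfolding d_def using \<delta> by (intro frac_le) auto
    then have d1: "d \<le> 1" by simp
    define U where "U = real N / d + 12 * A / R"
    have "1 / d = 4 * (real N + 1) * t ^ m"
      using t by (simp add: d_def \<delta>_def)
    also have "\<dots> \<le> D1 * t ^ K * t ^ m"
    proof (intro mult_right_mono)
      show "4 * (real N + 1) \<le> D1 * t ^ K"
        using N tK by (simp add: N_def D1_def A_def algebra_simps)
    qed (use t in auto)
    finally have inv_d: "1 / d \<le> D1 * t ^ (K + m)" by (simp add: power_add mult.assoc)
    have "U \<le> 2 * A1 * t ^ K * (D1 * t ^ (K + m)) + 12 * A1 * t ^ K"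
    proof -
      have "real N * (1 / d) \<le> 2 * A1 * t ^ K * (D1 * t ^ (K + m))"
        using inv_d N d A by (intro mult_mono) (auto simp: N_def A_def)
      moreover have "12 * A / R \<le> 12 * A / 1"
        using R A by (intro divide_left_mono) auto
      ultimately show ?thesis by (simp add: U_def A_def mult.assoc)
    qed
    also have "\<dots> \<le> 2 * A1 * t ^ K * (D1 * t ^ (K + m)) + 12 * A1 * t ^ (2 * K + m)"
      using A1 t by (intro add_left_mono mult_left_mono power_increasing) auto
    also have "\<dots> = U1 * t ^ (2 * K + m)"
    proof -
      have "t ^ (2 * K + m) = t ^ K * t ^ (K + m)"
        by (metis mult_2 power_add add.assoc)
      moreover have "2 * A1 * x * (D1 * y) + 12 * A1 * (x * y) = U1 * (x * y)" for x y
        by (simp add: U1_def algebra_simps)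
      ultimately show ?thesis by simp
    qed
    finally have U: "U \<le> U1 * t ^ (2 * K + m)" .
    have U0: "U \<ge> 0" using d A R by (simp add: U_def)
    have UD: "U \<le> D * t ^ L"
    proof -
      have "U1 * t ^ (2 * K + m) \<le> D * t ^ L"
        using U1 D1 t by (intro mult_mono power_increasing) (auto simp: D_def L_def)
      with U show ?thesis by linarith
    qed
    have UD2: "U / d + U\<^sup>2 \<le> D * t ^ L"
    proof -
      have "U * (1 / d) \<le> U1 * t ^ (2 * K + m) * (D1 * t ^ (K + m))"
        using U inv_d U0 d U1 t by (intro mult_mono) auto
      also have "\<dots> = U1 * D1 * t ^ (3 * K + 2 * m)"
        by (simp add: add.commute flip: power_add)
      also have "\<dots> \<le> U1 * D1 * t ^ L"
        using U1 D1 t by (intro mult_left_mono power_increasing) (auto simp: L_def)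
      finally have 1: "U / d \<le> U1 * D1 * t ^ L" by simp
      have "U\<^sup>2 \<le> (U1 * t ^ (2 * K + m))\<^sup>2"
        using U U0 by (rule power_mono)
      also have "\<dots> = U1\<^sup>2 * t ^ L"
        by (simp add: L_def power_mult_distrib algebra_simps flip: power_mult)
      finally have 2: "U\<^sup>2 \<le> U1\<^sup>2 * t ^ L" .
      have "U1 * D1 * t ^ L + U1\<^sup>2 * t ^ L \<le> D * t ^ L"
        using U1 t by (simp add: D_def algebra_simps)
      with 1 2 show ?thesis by linarith
    qed
    have quot: "f z \<noteq> 0 \<and> norm (deriv f z / f z) \<le> U \<and> norm (deriv (deriv f) z / f z) \<le> U / d + U\<^sup>2"
      if z: "norm (z - z0) = s" for z
    proof -
      have near: "f w \<noteq> 0 \<and> norm (deriv f w / f w) \<le> U" if w: "norm (z - w) \<le> d" for w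
        unfolding U_def N_def
      proof (rule u)
        have "norm w \<le> norm z0 + norm (z - z0) + norm (z - w)"
          using norm_triangle_ineq4[of z "z - w"] norm_triangle_ineq[of z0 "z - z0"] by simp
        then show "norm w \<le> R" using w d1 s(2) \<delta>(2) z by (simp add: R_def)
        fix a assume "a \<in> set as"
        then have "2 * d \<le> \<bar>norm (a - z0) - s\<bar>" unfolding two_d by (intro s(3)) auto
        also have "\<dots> \<le> norm (a - z)"
          using norm_triangle_ineq3[of "a - z0" "z - z0"] z by simp
        also have "\<dots> \<le> norm (w - a) + norm (z - w)"
          using norm_triangle_ineq[of "w - a" "z - w"] by (simp add: norm_minus_commute)
        finally show "d \<le> norm (w - a)" using w by simp
      qed (rule d)
      define v where "v w = deriv f w / f w" for w
      have df: "deriv f holomorphic_on UNIV" using f by (intro holomorphic_deriv) auto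
      have "v holomorphic_on cball z d"
        unfolding v_def using near
        by (intro holomorphic_on_divide holomorphic_on_subset[OF f] holomorphic_on_subset[OF df])
           (auto simp: dist_norm)
      moreover have "norm (v w) \<le> U" if "norm (z - w) = d" for w
        using near[of w] that by (simp add: v_def)
      ultimately have "norm ((deriv ^^ 1) v z) \<le> fact 1 * U / d ^ 1"
        using d by (intro Cauchy_inequality)
          (auto intro: holomorphic_on_subset holomorphic_on_imp_continuous_on)
      then have dv: "norm (deriv v z) \<le> U / d" by simp
      have fz: "f z \<noteq> 0" "norm (v z) \<le> U" using near[of z] d by (auto simp: v_def)
      have "(v has_field_derivative (deriv (deriv f) z * f z - deriv f z * deriv f z) / (f z * f z)) (at z)"
        unfolding v_def using fz
        by (intro DERIV_divide holomorphic_derivI[OF f] holomorphic_derivI[OF df]) auto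
      then have "deriv v z = (deriv (deriv f) z * f z - deriv f z * deriv f z) / (f z * f z)"
        by (rule DERIV_imp_deriv)
      then have "deriv (deriv f) z / f z = deriv v z + (v z)\<^sup>2"
        using fz by (simp add: v_def field_simps power2_eq_square)
      then have "norm (deriv (deriv f) z / f z) \<le> norm (deriv v z) + (norm (v z))\<^sup>2"
        by (metis norm_power norm_triangle_ineq)
      also have "\<dots> \<le> U / d + U\<^sup>2"
        using dv fz by (intro add_mono power_mono) auto
      finally show ?thesis using fz by (simp add: v_def)
    qed
    have st: "s * t ^ m \<le> 1"
      using mult_right_mono[OF s(2), of "t ^ m"] t \<delta>(3) by simp
    have "f z \<noteq> 0 \<and> norm (deriv f z / f z) \<le> D * t ^ L \<and> norm (deriv (deriv f) z / f z) \<le> D * t ^ L"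
      if "norm (z - z0) = s" for z
      using quot[OF that] UD UD2 by linarith
    with s(1) st show ?thesis
      unfolding t_def by blast
  qed
  then show ?thesis using D by blast
qed

text \<open>A translation moves a point where \<open>f\<close> does not vanish to the origin; by the
  submultiplicativity of \<open>1 + norm z\<close> it changes the bounds only by constant factors.
  The exponent \<open>m\<close> stays free, so the circles can be made to shrink faster than a given
  polynomial grows.\<close>

lemma logderiv_bounds_on_small_circle:
  fixes f :: "complex \<Rightarrow> complex" and m :: nat
  assumes f: "f holomorphic_on UNIV" and nz: "\<exists>z. f z \<noteq> 0" and fin: "entire_order f \<noteq> \<infinity>"
  shows "\<exists>D>0. \<exists>L::nat. \<forall>z0. \<exists>s>0. s \<le> 1 \<and> s * (1 + norm z0) ^ m \<le> D \<and>
    (\<forall>z. norm (z - z0) = s \<longrightarrow> f z \<noteq> 0 \<and> norm (deriv f z / f z) \<le> D * (1 + norm z0) ^ L \<and>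
       norm (deriv (deriv f) z / f z) \<le> D * (1 + norm z0) ^ L)"
proof -
  obtain p where p: "f p \<noteq> 0" using nz by blast
  obtain C K where C: "C > 0" and growth: "\<And>z. norm (f z) \<le> exp (C * (1 + norm z) ^ K)"
    using exp_power_bound_if_entire_order_finite[OF f fin] by blast
  define F where "F z = f (z + p)" for z
  define q where "q = 1 + norm p"
  have q: "q \<ge> 1" by (simp add: q_def)
  have shift: "1 + norm (z + w) \<le> (1 + norm z) * (1 + norm w)" for z w :: complex
  proof -
    have "(1 + norm z) * (1 + norm w) = 1 + norm z + norm w + norm z * norm w"
      by (simp add: algebra_simps)
    then show ?thesis
      using norm_triangle_ineq[of z w] mult_nonneg_nonneg[OF norm_ge_zero[of z] norm_ge_zero[of w]]
      by linarith
  qed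
  have "f \<circ> (\<lambda>z. z + p) holomorphic_on UNIV"
    by (intro holomorphic_on_compose holomorphic_intros holomorphic_on_subset[OF f]) auto
  then have F: "F holomorphic_on UNIV" by (simp add: F_def[abs_def] o_def)
  have deriv_shift: "deriv (\<lambda>z. g (z + p)) z = deriv g (z + p)" if "g holomorphic_on UNIV" for g z
  proof (rule DERIV_imp_deriv)
    have "(g has_field_derivative deriv g (z + p)) (at (z + p))"
      by (rule holomorphic_derivI[OF that]) auto
    then show "((\<lambda>z. g (z + p)) has_field_derivative deriv g (z + p)) (at z)"
      by (simp add: DERIV_shift)
  qed
  have dF: "deriv F z = deriv f (z + p)" for z
    unfolding F_def by (rule deriv_shift[OF f])
  have df: "deriv f holomorphic_on UNIV" using f by (intro holomorphic_deriv) auto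
  have ddF: "deriv (deriv F) z = deriv (deriv f) (z + p)" for z
    unfolding dF[abs_def] by (rule deriv_shift[OF df])
  have growthF: "norm (F z) \<le> exp (C * q ^ K * (1 + norm z) ^ K)" for z
  proof -
    have "C * (1 + norm (z + p)) ^ K \<le> C * ((1 + norm z) * q) ^ K"
      unfolding q_def using C shift[of z p]
      by (intro mult_left_mono power_mono) (auto intro: add_nonneg_nonneg)
    also have "\<dots> = C * q ^ K * (1 + norm z) ^ K" by (simp add: power_mult_distrib)
    finally show ?thesis
      unfolding F_def using growth[of "z + p"] by (meson exp_le_cancel_iff order_trans)
  qed
  have "F 0 \<noteq> 0" "C * q ^ K > 0" using p C q by (auto simp: F_def)
  from logderiv_bounds_on_small_circle_0[OF F this growthF, of m]
  obtain D L where D: "D > 0" and ex: "\<And>z0. \<exists>s>0. s * (1 + norm z0) ^ m \<le> 1 \<and>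
    (\<forall>z. norm (z - z0) = s \<longrightarrow> F z \<noteq> 0 \<and> norm (deriv F z / F z) \<le> D * (1 + norm z0) ^ L \<and>
       norm (deriv (deriv F) z / F z) \<le> D * (1 + norm z0) ^ L)"
    by blast
  \<comment> \<open>The first summand covers the two quotients after translation, the second the
    radius.\<close>
  define E where "E = D * q ^ L + q ^ m"
  have E: "E > 0" using D q by (simp add: E_def add_pos_pos)
  have "\<exists>s>0. s \<le> 1 \<and> s * (1 + norm z0) ^ m \<le> E \<and>
    (\<forall>z. norm (z - z0) = s \<longrightarrow> f z \<noteq> 0 \<and> norm (deriv f z / f z) \<le> E * (1 + norm z0) ^ L \<and>
       norm (deriv (deriv f) z / f z) \<le> E * (1 + norm z0) ^ L)" for z0
  proof -
    define y0 where "y0 = z0 - p"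
    obtain s where s: "s > 0" "s * (1 + norm y0) ^ m \<le> 1"
      and b: "\<And>z. norm (z - y0) = s \<Longrightarrow> F z \<noteq> 0 \<and> norm (deriv F z / F z) \<le> D * (1 + norm y0) ^ L \<and>
         norm (deriv (deriv F) z / F z) \<le> D * (1 + norm y0) ^ L"
      using ex[of y0] by blast
    have "s * 1 \<le> s * (1 + norm y0) ^ m" using s(1) by (intro mult_left_mono) auto
    then have s1: "s \<le> 1" using s(2) by linarith
    have "s * (1 + norm z0) ^ m \<le> s * ((1 + norm y0) * q) ^ m"
      using s(1) shift[of y0 p] by (intro mult_left_mono power_mono) (auto simp: y0_def q_def)
    also have "\<dots> = s * (1 + norm y0) ^ m * q ^ m" by (simp add: power_mult_distrib)
    also have "\<dots> \<le> 1 * q ^ m" using s(2) q by (intro mult_right_mono) auto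
    also have "\<dots> \<le> E" using D q by (simp add: E_def)
    finally have sE: "s * (1 + norm z0) ^ m \<le> E" .
    have "D * (1 + norm y0) ^ L \<le> D * ((1 + norm z0) * q) ^ L"
      using D shift[of z0 "- p"] by (intro mult_left_mono power_mono) (auto simp: y0_def q_def)
    also have "\<dots> = D * q ^ L * (1 + norm z0) ^ L" by (simp add: power_mult_distrib)
    also have "\<dots> \<le> E * (1 + norm z0) ^ L" using q by (intro mult_right_mono) (auto simp: E_def)
    finally have DE: "D * (1 + norm y0) ^ L \<le> E * (1 + norm z0) ^ L" .
    have "f z \<noteq> 0 \<and> norm (deriv f z / f z) \<le> E * (1 + norm z0) ^ L \<and>
       norm (deriv (deriv f) z / f z) \<le> E * (1 + norm z0) ^ L" if "norm (z - z0) = s" for z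
    proof -
      have "norm ((z - p) - y0) = s" using that by (simp add: y0_def)
      from b[OF this] DE show ?thesis unfolding dF ddF by (auto simp: F_def)
    qed
    with s(1) s1 sE show ?thesis by blast
  qed
  with E show ?thesis by blast
qed

subsection \<open>A Phragmen-Lindelof principle\<close>

text \<open>The Lipschitz part, with its polynomially growing constant, shows that a polynomial is
  nearly constant on circles shrinking like \<open>1 / (1 + norm w) ^ m\<close>. The size bound is
  included to make the induction over the coefficients work.\<close>

lemma poly_power_bounds:
  fixes p :: "complex poly"
  shows "\<exists>L>0. \<exists>m. \<forall>w. norm (poly p w) \<le> L * (1 + norm w) ^ m \<and>
    (\<forall>z. norm (z - w) \<le> 1 \<longrightarrow> norm (poly p z - poly p w) \<le> L * (1 + norm w) ^ m * norm (z - w))"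
proof (induction p)
  case 0
  show ?case by (intro exI[of _ 1] conjI) auto
next
  case (pCons a p)
  then obtain L m where L: "L > 0" and b: "\<And>w. norm (poly p w) \<le> L * (1 + norm w) ^ m"
    and lip: "\<And>w z. norm (z - w) \<le> 1 \<Longrightarrow>
      norm (poly p z - poly p w) \<le> L * (1 + norm w) ^ m * norm (z - w)" by blast
  define L' where "L' = 2 * L + norm a"
  have "norm (poly (pCons a p) w) \<le> L' * (1 + norm w) ^ Suc m \<and>
    (\<forall>z. norm (z - w) \<le> 1 \<longrightarrow>
      norm (poly (pCons a p) z - poly (pCons a p) w) \<le> L' * (1 + norm w) ^ Suc m * norm (z - w))" for w
  proof -
    define t where "t = 1 + norm w"
    have t: "t \<ge> 1" "norm w \<le> t" by (auto simp: t_def)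
    have bt: "norm (poly p w) \<le> L * t ^ m" using b by (simp add: t_def)
    have one: "1 \<le> t ^ Suc m" using t(1) by (rule one_le_power)
    have le: "(2 * L) * t ^ Suc m \<le> L' * t ^ Suc m"
      using t by (intro mult_right_mono) (auto simp: L'_def)
    have "norm (poly (pCons a p) w) \<le> norm a + norm w * norm (poly p w)"
      using norm_triangle_ineq[of a "w * poly p w"] by (simp add: norm_mult)
    also have "\<dots> \<le> norm a * t ^ Suc m + t * (L * t ^ m)"
      using bt t one L mult_left_mono[OF one norm_ge_zero[of a]] by (intro add_mono mult_mono) auto
    also have "\<dots> \<le> L' * t ^ Suc m"
      using L t by (simp add: L'_def algebra_simps)
    finally have 1: "norm (poly (pCons a p) w) \<le> L' * t ^ Suc m" .
    have "norm (poly (pCons a p) z - poly (pCons a p) w) \<le> L' * t ^ Suc m * norm (z - w)"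
      if "norm (z - w) \<le> 1" for z
    proof -
      have z: "norm z \<le> t" using that norm_triangle_ineq2[of z w] by (simp add: t_def)
      \<comment> \<open>The product rule for differences: the first term uses the Lipschitz bound
        for \<open>p\<close>, the second its size bound.\<close>
      have "poly (pCons a p) z - poly (pCons a p) w = z * (poly p z - poly p w) + (z - w) * poly p w"
        by (simp add: algebra_simps)
      then have "norm (poly (pCons a p) z - poly (pCons a p) w)
          \<le> norm z * norm (poly p z - poly p w) + norm (z - w) * norm (poly p w)"
        using norm_triangle_ineq[of "z * (poly p z - poly p w)" "(z - w) * poly p w"]
        by (simp add: norm_mult)
      also have "\<dots> \<le> t * (L * t ^ m * norm (z - w)) + norm (z - w) * (L * t ^ Suc m)"
      proof (intro add_mono mult_mono)
        show "norm (poly p z - poly p w) \<le> L * t ^ m * norm (z - w)"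
          using lip[OF that] by (simp add: t_def)
        have "L * t ^ m \<le> L * t ^ Suc m"
          using t L by (intro mult_left_mono power_increasing) auto
        with bt show "norm (poly p w) \<le> L * t ^ Suc m" by linarith
      qed (use z t in auto)
      also have "\<dots> = 2 * L * t ^ Suc m * norm (z - w)" by (simp add: algebra_simps)
      also have "\<dots> \<le> L' * t ^ Suc m * norm (z - w)"
        using le by (rule mult_right_mono) auto
      finally show ?thesis .
    qed
    with 1 show ?thesis by (simp add: t_def)
  qed
  moreover have "L' > 0" using L by (simp add: L'_def add_pos_nonneg)
  ultimately show ?case by blast
qed

text \<open>Two-sided comparison with the leading power permits exchanging powers of
  \<open>norm (poly Q z)\<close> for powers of \<open>norm z\<close> later on.\<close>

lemma poly_growth_exact:
  fixes p :: "complex poly"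
  assumes "p \<noteq> 0"
  shows "\<exists>c>0. \<exists>C\<ge>c. \<exists>R\<ge>1. \<forall>z. norm z \<ge> R \<longrightarrow>
    c * norm z ^ degree p \<le> norm (poly p z) \<and> norm (poly p z) \<le> C * norm z ^ degree p"
  using assms
proof (induction p)
  case 0
  then show ?case by simp
next
  case (pCons a p)
  show ?case
  proof (cases "p = 0")
    case True
    then show ?thesis using pCons
      by (intro exI[of _ "norm a"] conjI exI[of _ "1::real"]) auto
  next
    case False
    then obtain c C R where c: "c > 0" "C \<ge> c" "R \<ge> 1" and b: "\<And>z. norm z \<ge> R \<Longrightarrow>
      c * norm z ^ degree p \<le> norm (poly p z) \<and> norm (poly p z) \<le> C * norm z ^ degree p"
      using pCons.IH by blast
    \<comment> \<open>Beyond this radius the constant coefficient costs at most half of the lower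
      bound.\<close>
    define R' where "R' = max R (2 * norm a / c)"
    have "c / 2 * norm z ^ Suc (degree p) \<le> norm (poly (pCons a p) z) \<and>
        norm (poly (pCons a p) z) \<le> (C + norm a) * norm z ^ Suc (degree p)" if z: "norm z \<ge> R'" for z
    proof -
      have zR: "norm z \<ge> R" "norm z \<ge> 1" "norm z \<ge> 2 * norm a / c" using z c by (auto simp: R'_def)
      have pw: "norm z \<le> norm z ^ Suc (degree p)"
        using zR(2) power_increasing[of 1 "Suc (degree p)" "norm z"] by simp
      have "norm a \<le> c / 2 * norm z" using zR(3) c by (simp add: field_simps)
      also have "\<dots> \<le> c / 2 * norm z ^ Suc (degree p)"
        using pw c by (intro mult_left_mono) auto
      finally have a: "norm a \<le> c / 2 * norm z ^ Suc (degree p)" .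
      have lo: "c * norm z ^ Suc (degree p) \<le> norm (z * poly p z)"
        using mult_left_mono[OF conjunct1[OF b[OF zR(1)]], of "norm z"] by (simp add: norm_mult algebra_simps)
      have hi: "norm (z * poly p z) \<le> C * norm z ^ Suc (degree p)"
        using mult_left_mono[OF conjunct2[OF b[OF zR(1)]], of "norm z"] by (simp add: norm_mult algebra_simps)
      have "norm a * 1 \<le> norm a * norm z ^ Suc (degree p)"
        using zR(2) by (intro mult_left_mono one_le_power) auto
      then have "norm (poly (pCons a p) z) \<le> (C + norm a) * norm z ^ Suc (degree p)"
        using hi norm_triangle_ineq[of a "z * poly p z"] by (simp add: distrib_right)
      moreover have "c / 2 * norm z ^ Suc (degree p) \<le> norm (poly (pCons a p) z)"
        using lo a norm_triangle_ineq2[of "z * poly p z" "- a"] by (simp add: add.commute)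
      ultimately show ?thesis by blast
    qed
    moreover have "c / 2 > 0" "C + norm a \<ge> c / 2" "R' \<ge> 1"
      using c norm_ge_zero[of a] by (auto simp: R'_def le_max_iff_disj simp del: norm_ge_zero)
    ultimately show ?thesis using False by (metis degree_pCons_eq)
  qed
qed

lemma norm_powr_of_real:
  assumes "w \<noteq> 0"
  shows "norm (w powr complex_of_real \<tau>) = norm w powr \<tau>"
  using assms by (simp add: powr_def)

text \<open>In the closed right half-plane the argument is at most \<open>pi / 2\<close> in absolute
  value, so that of the power is at most \<open>\<tau> * pi / 2\<close>, and the cosine decreases on
  this range. For \<open>\<tau> < 1\<close> the factor is positive even on the imaginary
  axis.\<close>

lemma Re_powr_of_real_ge:
  assumes w: "w \<noteq> 0" "Re w \<ge> 0" and \<tau>: "0 \<le> \<tau>" "\<tau> \<le> 1"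
  shows "cos (\<tau> * pi / 2) * norm w powr \<tau> \<le> Re (w powr complex_of_real \<tau>)"
proof -
  have arg: "\<bar>Im (Ln w)\<bar> \<le> pi / 2" using Re_Ln_pos_le w by blast
  have "cos (\<tau> * pi / 2) \<le> cos (\<tau> * \<bar>Im (Ln w)\<bar>)"
  proof (rule cos_monotone_0_pi_le)
    show "\<tau> * \<bar>Im (Ln w)\<bar> \<le> \<tau> * pi / 2"
      using mult_left_mono[OF arg \<tau>(1)] by simp
    show "\<tau> * pi / 2 \<le> pi"
      using mult_right_mono[OF \<tau>(2), of pi] pi_gt_zero by linarith
  qed (use \<tau> in auto)
  also have "\<dots> = cos (\<tau> * Im (Ln w))"
    using \<tau> by (metis abs_mult abs_of_nonneg cos_abs_real)
  finally have "cos (\<tau> * pi / 2) * norm w powr \<tau> \<le> cos (\<tau> * Im (Ln w)) * norm w powr \<tau>"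
    by (intro mult_right_mono) auto
  also have "\<dots> = Re (w powr complex_of_real \<tau>)"
    using w by (simp add: powr_def Re_exp)
  finally show ?thesis .
qed

text \<open>
  The comparison functions are the principal powers \<open>Q powr \<tau>\<close> with \<open>\<tau> < 1\<close>, whose real part dominates
  a multiple of \<open>|Q| powr \<tau>\<close> wherever \<open>Re Q \<ge> 0\<close>. Hence the components of \<open>Re Q > 0\<close> need not be
  described.
\<close>

lemma Phragmen_Lindelof_poly:
  fixes Q :: "complex poly" and h :: "complex \<Rightarrow> complex"
  assumes h: "h holomorphic_on UNIV" and deg: "degree Q = n" "n \<ge> 1"
    and \<sigma>: "0 < \<sigma>" "\<sigma> < real n" and \<rho>: "\<rho> < real n"
    and growth: "\<And>z. norm z \<ge> R0 \<Longrightarrow> norm (h z) \<le> exp (norm z powr \<rho>)"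
    and bd: "\<And>z. norm z \<ge> R0 \<Longrightarrow> Re (poly Q z) = 0 \<Longrightarrow> norm (h z) \<le> exp (norm z powr \<sigma>)"
  shows "\<exists>C R. \<forall>z. norm z \<ge> R \<longrightarrow> Re (poly Q z) \<ge> 0 \<longrightarrow> norm (h z) \<le> exp (C * norm z powr \<sigma>)"
proof -
  have "Q \<noteq> 0" using deg by auto
  from poly_growth_exact[OF this] obtain c Cq R1 where c: "c > 0" "Cq \<ge> c" "R1 \<ge> 1"
    and Q: "\<And>z. norm z \<ge> R1 \<Longrightarrow> c * norm z ^ n \<le> norm (poly Q z) \<and> norm (poly Q z) \<le> Cq * norm z ^ n"
    unfolding deg(1) by blast
  define R where "R = max R0 R1"
  have R: "R \<ge> R0" "R \<ge> R1" "R \<ge> 1" using c by (auto simp: R_def)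
  \<comment> \<open>An exponent strictly between \<open>max \<rho> 0\<close> and \<open>n\<close>:
    above \<open>\<rho>\<close> it beats the growth of \<open>h\<close>, below \<open>n\<close> it
    makes \<open>\<kappa>'\<close> positive.\<close>
  define \<rho>' where "\<rho>' = (max \<rho> 0 + real n) / 2"
  have \<rho>': "\<rho> < \<rho>'" "0 < \<rho>'" "\<rho>' < real n" using \<rho> deg(2) by (auto simp: \<rho>'_def max_def)
  \<comment> \<open>As \<open>norm (poly Q z)\<close> is comparable to \<open>norm z ^ n\<close>,
    its powers with exponents \<open>\<tau>\<close> and \<open>\<tau>'\<close> correspond to
    \<open>norm z powr \<sigma>\<close> and \<open>norm z powr \<rho>'\<close>.\<close>
  define \<tau> where "\<tau> = \<sigma> / real n"
  define \<tau>' where "\<tau>' = \<rho>' / real n"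
  have \<tau>: "0 < \<tau>" "\<tau> < 1" "0 < \<tau>'" "\<tau>' < 1" using \<sigma> \<rho>' deg(2) by (auto simp: \<tau>_def \<tau>'_def)
  define \<kappa> where "\<kappa> = cos (\<tau> * pi / 2)"
  define \<kappa>' where "\<kappa>' = cos (\<tau>' * pi / 2)"
  have \<kappa>: "\<kappa> > 0" "\<kappa>' > 0" unfolding \<kappa>_def \<kappa>'_def using \<tau> by (auto intro!: cos_gt_zero)
  \<comment> \<open>Normalized so that the real part of the first comparison term is at least
    \<open>norm w powr \<sigma>\<close>, the bound assumed on the curves
    \<open>Re (poly Q w) = 0\<close>.\<close>
  define K where "K = 1 / (\<kappa> * c powr \<tau>)"
  have K: "K > 0" "K * \<kappa> * c powr \<tau> = 1" using \<kappa> c by (auto simp: K_def)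
  have npow: "(b * r ^ n) powr (s / real n) = b powr (s / real n) * r powr s"
    if "b > 0" "r > 0" for b r s
    using that deg(2) by (simp add: powr_mult powr_powr flip: powr_realpow)
  have "bounded (h ` sphere 0 R)"
    by (intro compact_imp_bounded compact_continuous_image
        continuous_on_subset[OF holomorphic_on_imp_continuous_on[OF h]]) auto
  then obtain M0 where M0: "\<forall>w\<in>h ` sphere 0 R. norm w \<le> M0"
    unfolding bounded_iff by blast
  define M where "M = max 1 M0"
  have M: "M \<ge> 1" "\<And>z. norm z = R \<Longrightarrow> norm (h z) \<le> M"
    using M0 by (auto simp: M_def le_max_iff_disj)
  have Qnz: "poly Q w \<noteq> 0" if "norm w \<ge> R" for w
  proof -
    have "0 < c * norm w ^ n" using c that R by (intro mult_pos_pos zero_less_power) linarith+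
    then show ?thesis using Q[of w] that R by fastforce
  qed
  \<comment> \<open>The \<open>\<epsilon>\<close> term tames the growth of \<open>h\<close> far out;
    since \<open>M\<close> does not depend on \<open>\<epsilon>\<close>, it can be removed by a
    limit afterwards.\<close>
  have main: "norm (h z) \<le> M * exp (K * norm (poly Q z) powr \<tau> + \<epsilon> * norm (poly Q z) powr \<tau>')"
    if z: "norm z \<ge> R" "Re (poly Q z) \<ge> 0" and \<epsilon>: "\<epsilon> > 0" for z \<epsilon>
  proof -
    define E where "E w = K * poly Q w powr complex_of_real \<tau> + \<epsilon> * poly Q w powr complex_of_real \<tau>'" for w
    define H where "H w = h w * exp (- E w)" for w
    define e where "e = \<epsilon> * \<kappa>' * c powr \<tau>'"
    have e: "e > 0" using \<epsilon> \<kappa> c by (simp add: e_def)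
    have ReE: "norm w powr \<sigma> + e * norm w powr \<rho>' \<le> Re (E w)"
      if w: "norm w \<ge> R" "Re (poly Q w) \<ge> 0" for w
    proof -
      have wpos: "norm w > 0" using w R by linarith
      have Qw: "c * norm w ^ n \<le> norm (poly Q w)" using Q w R by auto
      have "norm w powr \<sigma> = K * (\<kappa> * (c * norm w ^ n) powr \<tau>)"
        unfolding \<tau>_def npow[OF c(1) wpos] using K(2) by (simp add: \<tau>_def)
      also have "\<dots> \<le> K * (\<kappa> * norm (poly Q w) powr \<tau>)"
        using K(1) \<kappa> Qw \<tau> c by (intro mult_left_mono powr_mono2) auto
      also have "\<dots> \<le> K * Re (poly Q w powr complex_of_real \<tau>)"
        unfolding \<kappa>_def using K(1) \<tau> w Qnz
        by (intro mult_left_mono Re_powr_of_real_ge) auto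
      finally have 1: "norm w powr \<sigma> \<le> K * Re (poly Q w powr complex_of_real \<tau>)" .
      have "e * norm w powr \<rho>' = \<epsilon> * (\<kappa>' * (c * norm w ^ n) powr \<tau>')"
        unfolding \<tau>'_def npow[OF c(1) wpos] by (simp add: e_def \<tau>'_def)
      also have "\<dots> \<le> \<epsilon> * (\<kappa>' * norm (poly Q w) powr \<tau>')"
        using \<epsilon> \<kappa> Qw \<tau> c by (intro mult_left_mono powr_mono2) auto
      also have "\<dots> \<le> \<epsilon> * Re (poly Q w powr complex_of_real \<tau>')"
        unfolding \<kappa>'_def using \<epsilon> \<tau> w Qnz
        by (intro mult_left_mono Re_powr_of_real_ge) auto
      finally have 2: "e * norm w powr \<rho>' \<le> \<epsilon> * Re (poly Q w powr complex_of_real \<tau>')" .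
      show ?thesis using 1 2 by (simp add: E_def)
    qed
    have normH: "norm (H w) = norm (h w) * exp (- Re (E w))" for w
      by (simp add: H_def norm_mult)
    have ReE0: "0 \<le> Re (E w)" if "norm w \<ge> R" "Re (poly Q w) \<ge> 0" for w
      using order_trans[OF _ ReE[OF that], of 0] e by (simp add: add_nonneg_nonneg)
    have "\<forall>\<^sub>F r in at_top. r powr \<rho> \<le> e * r powr \<rho>'"
      using e \<rho>'(1) by real_asymp
    then obtain r0 where r0: "\<And>r. r \<ge> r0 \<Longrightarrow> r powr \<rho> \<le> e * r powr \<rho>'"
      by (auto simp: eventually_at_top_linorder)
    \<comment> \<open>The outer radius may depend on \<open>z\<close> and \<open>\<epsilon>\<close>:
      it encloses \<open>z\<close> and is so large that the \<open>\<epsilon>\<close> term dominates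
      the growth bound.\<close>
    define R2 where "R2 = max r0 (max R (norm z)) + 1"
    have R2: "R2 \<ge> r0" "R2 > R" "R2 > norm z" by (auto simp: R2_def)
    \<comment> \<open>On the inner circle \<open>M\<close> bounds \<open>h\<close> and
      \<open>Re (E w) \<ge> 0\<close>; on the curves the term with \<open>K\<close> suffices; on the
      outer circle the \<open>\<epsilon>\<close> term does.\<close>
    have bdry: "norm (H w) \<le> M" if w: "norm w \<ge> R" "Re (poly Q w) \<ge> 0"
      "norm w = R \<or> Re (poly Q w) = 0 \<or> norm w = R2" for w
    proof (cases "norm w = R")
      case True
      have "norm (h w) * exp (- Re (E w)) \<le> M * 1"
        using M True ReE0[OF w(1,2)] by (intro mult_mono) auto
      then show ?thesis by (simp add: normH)
    next
      case False
      have "norm (h w) \<le> exp (Re (E w))"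
      proof (cases "Re (poly Q w) = 0")
        case True
        have "norm (h w) \<le> exp (norm w powr \<sigma>)" using bd w R True by auto
        also have "norm w powr \<sigma> \<le> Re (E w)"
          using ReE[OF w(1,2)] e by (smt (verit) mult_nonneg_nonneg powr_ge_zero)
        finally show ?thesis by simp
      next
        case False
        then have wR2: "norm w = R2" using w(3) \<open>norm w \<noteq> R\<close> by auto
        have "norm (h w) \<le> exp (norm w powr \<rho>)" using growth w R by auto
        also have "norm w powr \<rho> \<le> e * norm w powr \<rho>'" using r0 wR2 R2 by auto
        also have "\<dots> \<le> Re (E w)"
          using ReE[OF w(1,2)] by (smt (verit) powr_ge_zero)
        finally show ?thesis by simp
      qed
      then have "norm (h w) * exp (- Re (E w)) \<le> 1" by (simp add: exp_minus field_simps)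
      then show ?thesis using M(1) by (simp add: normH)
    qed
    have HM: "norm (H z) \<le> M"
    proof (cases "norm z = R \<or> Re (poly Q z) = 0")
      case True
      then show ?thesis using bdry z by blast
    next
      case False
      \<comment> \<open>The open set \<open>S\<close> may be disconnected, which the maximum
        principle in its frontier form permits; a frontier point lies in \<open>T\<close> but not in
        \<open>S\<close>, hence is of one of the three kinds in \<open>bdry\<close>.\<close>
      define S where "S = {w. R < norm w \<and> norm w < R2 \<and> 0 < Re (poly Q w)}"
      define T where "T = {w. R \<le> norm w \<and> norm w \<le> R2 \<and> 0 \<le> Re (poly Q w)}"
      have S: "open S" unfolding S_def
        by (intro open_Collect_conj open_Collect_less continuous_intros)
      have "closed T" unfolding T_def
        by (intro closed_Collect_conj closed_Collect_le continuous_intros)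
      then have cl: "closure S \<subseteq> T" by (intro closure_minimal) (auto simp: S_def T_def)
      \<comment> \<open>On \<open>T\<close> the polynomial has nonnegative real part and no zero, so
        it avoids the branch cut and its principal powers are holomorphic.\<close>
      have nonneg_real: "poly Q w \<notin> \<real>\<^sub>\<le>\<^sub>0" if "w \<in> T" for w
        using that Qnz[of w] by (auto simp: T_def complex_nonpos_Reals_iff complex_eq_iff)
      have H: "H holomorphic_on T"
        unfolding H_def E_def using nonneg_real
        by (intro holomorphic_intros holomorphic_on_subset[OF h]) auto
      show ?thesis
      proof (rule maximum_modulus_frontier[of H S])
        show "H holomorphic_on interior S"
          using H cl closure_subset interior_subset holomorphic_on_subset by (metis order_trans)
        show "continuous_on (closure S) H"
          using H cl by (meson holomorphic_on_imp_continuous_on continuous_on_subset)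
        show "bounded S"
          by (rule bounded_subset[of "ball 0 R2"]) (auto simp: S_def)
        show "z \<in> S" using z False R2 by (auto simp: S_def)
        fix w assume "w \<in> frontier S"
        then have "w \<in> T" "w \<notin> S" using S cl by (auto simp: frontier_def interior_open)
        then show "norm (H w) \<le> M" by (intro bdry) (auto simp: S_def T_def)
      qed
    qed
    have "norm (h z) = norm (H z) * exp (Re (E z))"
      by (simp add: normH exp_minus)
    also have "\<dots> \<le> M * exp (K * norm (poly Q z) powr \<tau> + \<epsilon> * norm (poly Q z) powr \<tau>')"
    proof (intro mult_mono)
      have "Re (poly Q z powr complex_of_real s) \<le> norm (poly Q z) powr s" for s
        using complex_Re_le_cmod[of "poly Q z powr complex_of_real s"] norm_powr_of_real[OF Qnz[OF z(1)]]
        by simp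
      then show "exp (Re (E z)) \<le> exp (K * norm (poly Q z) powr \<tau> + \<epsilon> * norm (poly Q z) powr \<tau>')"
        using K \<epsilon> by (auto simp: E_def intro!: add_mono mult_left_mono)
    qed (use HM M in auto)
    finally show ?thesis .
  qed
  define C where "C = M + K * Cq powr \<tau>"
  have "norm (h z) \<le> exp (C * norm z powr \<sigma>)" if z: "norm z \<ge> R" "Re (poly Q z) \<ge> 0" for z
  proof -
    let ?a = "norm (poly Q z)"
    \<comment> \<open>Here \<open>z\<close> is fixed while \<open>\<epsilon>\<close> tends to 0 from
      the right in \<open>main\<close>.\<close>
    have "((\<lambda>\<epsilon>. M * exp (K * ?a powr \<tau> + \<epsilon> * ?a powr \<tau>')) \<longlongrightarrow> M * exp (K * ?a powr \<tau> + 0 * ?a powr \<tau>')) (at_right 0)"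
      by (intro tendsto_intros)
    moreover have "\<forall>\<^sub>F \<epsilon> in at_right 0. norm (h z) \<le> M * exp (K * ?a powr \<tau> + \<epsilon> * ?a powr \<tau>')"
      using eventually_at_right_less[of "0::real"] by eventually_elim (rule main[OF z])
    ultimately have "norm (h z) \<le> M * exp (K * ?a powr \<tau> + 0 * ?a powr \<tau>')"
      by (rule tendsto_lowerbound) simp
    also have "\<dots> = M * exp (K * ?a powr \<tau>)" by simp
    also have "\<dots> \<le> exp (M * norm z powr \<sigma>) * exp (K * (Cq powr \<tau> * norm z powr \<sigma>))"
    proof (intro mult_mono)
      have "1 \<le> norm z powr \<sigma>" using z R \<sigma> by (intro ge_one_powr_ge_zero) auto
      then have "M * 1 \<le> M * norm z powr \<sigma>" using M by (intro mult_left_mono) auto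
      also have "\<dots> \<le> exp (M * norm z powr \<sigma>)"
        using exp_ge_add_one_self[of "M * norm z powr \<sigma>"] by linarith
      finally show "M \<le> exp (M * norm z powr \<sigma>)" by simp
      have "?a powr \<tau> \<le> (Cq * norm z ^ n) powr \<tau>"
        using Q[of z] z R \<tau> by (intro powr_mono2) auto
      also have "\<dots> = Cq powr \<tau> * norm z powr \<sigma>"
        unfolding \<tau>_def using c z R by (intro npow) auto
      finally show "exp (K * ?a powr \<tau>) \<le> exp (K * (Cq powr \<tau> * norm z powr \<sigma>))"
        using K by simp
    qed auto
    also have "\<dots> = exp (C * norm z powr \<sigma>)"
      by (simp add: C_def exp_add[symmetric] algebra_simps)
    finally show ?thesis .
  qed
  then show ?thesis by blast
qed

subsection \<open>The differential equation\<close>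

theorem theorem3:
  fixes P1 P0 :: "complex poly" and h1 h0 f :: "complex \<Rightarrow> complex" and n :: nat and c :: real
  assumes "n \<ge> 1"
    and "degree P1 = n" and "degree P0 = n"
    and "h1 holomorphic_on UNIV" and "h0 holomorphic_on UNIV"
    and "\<exists>z. h1 z \<noteq> 0" and "\<exists>z. h0 z \<noteq> 0"
    and "entire_order h1 < ereal (real (degree P1))"
    and "entire_order h0 < ereal (real (degree P0))"
    and "c \<ge> 1" and "degree (P1 - smult (complex_of_real c) P0) = 0"
    and "entire_order h1 < entire_lower_order h0"
    and "entire_lower_order h0 \<le> ereal (1/2)"
    and "f holomorphic_on UNIV"
    and "\<And>z. deriv (deriv f) z + h1 z * exp (poly P1 z) * deriv f z
               + h0 z * exp (poly P0 z) * f z = 0"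
    and "\<exists>z. f z \<noteq> 0"
  shows "entire_order f = \<infinity>"
proof (rule ccontr)
  assume fin: "entire_order f \<noteq> \<infinity>"
  \<comment> \<open>Three exponents between the order of \<open>h1\<close> and the lower order of
    \<open>h0\<close>: \<open>\<sigma>1\<close> bounds \<open>h1\<close>, the gap up to
    \<open>\<sigma>\<close> absorbs the polynomial factors from the quotients, and the gap up to
    \<open>\<mu>\<close> absorbs the constants from Phragmen-Lindelof.\<close>
  obtain \<sigma>1 where \<sigma>1: "entire_order h1 < ereal \<sigma>1" "ereal \<sigma>1 < entire_lower_order h0"
    using ereal_dense2[OF assms(12)] by blast
  obtain \<sigma> where \<sigma>: "\<sigma>1 < \<sigma>" "ereal \<sigma> < entire_lower_order h0"
    using ereal_dense2[OF \<sigma>1(2)] by auto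
  obtain \<mu> where \<mu>: "\<sigma> < \<mu>" "ereal \<mu> < entire_lower_order h0"
    using ereal_dense2[OF \<sigma>(2)] by auto
  obtain \<rho> where \<rho>: "entire_order h0 < ereal \<rho>" "\<rho> < real n"
    using ereal_dense2[OF assms(9)] assms(3) by auto
  have "0 < ereal \<sigma>1" using entire_order_nonneg[of h1] \<sigma>1(1) by (rule le_less_trans)
  then have \<sigma>1_pos: "0 < \<sigma>1" by simp
  \<comment> \<open>From \<open>\<sigma> < 1 / 2\<close> and \<open>n \<ge> 1\<close> follows
    \<open>\<sigma> < n\<close>, as the Phragmen-Lindelof principle requires.\<close>
  have "ereal \<sigma> < ereal (1 / 2)" using \<sigma>(2) assms(13) by (rule less_le_trans)
  then have \<sigma>n: "0 < \<sigma>" "\<sigma> < real n" using \<sigma>1_pos \<sigma>(1) assms(1) by auto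
  obtain R1 where R1: "\<And>z. norm z \<ge> R1 \<Longrightarrow> norm (h1 z) \<le> exp (norm z powr \<sigma>1)"
    using exp_powr_bound_if_entire_order_less[OF assms(4) \<sigma>1(1)] by blast
  obtain R2 where R2: "\<And>z. norm z \<ge> R2 \<Longrightarrow> norm (h0 z) \<le> exp (norm z powr \<rho>)"
    using exp_powr_bound_if_entire_order_less[OF assms(5) \<rho>(1)] by blast
  obtain L m where L: "L > 0" and lip: "\<And>w z. norm (z - w) \<le> 1 \<Longrightarrow>
      norm (poly P0 z - poly P0 w) \<le> L * (1 + norm w) ^ m * norm (z - w)"
    using poly_power_bounds[of P0] by blast
  \<comment> \<open>The circles shrink at the rate \<open>m\<close> of the Lipschitz bound for
    \<open>P0\<close>, so \<open>P0\<close> varies by at most \<open>L * D\<close> on each of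
    them.\<close>
  obtain D l where D: "D > 0" and circle: "\<And>z0. \<exists>s>0. s \<le> 1 \<and> s * (1 + norm z0) ^ m \<le> D \<and>
    (\<forall>z. norm (z - z0) = s \<longrightarrow> f z \<noteq> 0 \<and> norm (deriv f z / f z) \<le> D * (1 + norm z0) ^ l \<and>
       norm (deriv (deriv f) z / f z) \<le> D * (1 + norm z0) ^ l)"
    using logderiv_bounds_on_small_circle[OF assms(14,16) fin, of m] by blast
  obtain k where "P1 - smult (complex_of_real c) P0 = [:k:]"
    using assms(11) by (rule degree_eq_zeroE)
  then have "P1 = smult (complex_of_real c) P0 + [:k:]" by (simp add: diff_eq_eq add.commute)
  then have P1: "poly P1 z = c * poly P0 z + k" for z by simp
  define B where "B = L * D"
  have B: "B > 0" using L D by (simp add: B_def)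
  \<comment> \<open>The factor \<open>exp B\<close> pays for dividing by
    \<open>exp (poly P0 z)\<close>, the first \<open>D\<close> for \<open>f'' / f\<close>, and the
    last product for \<open>exp (poly P1 z)\<close> times \<open>f' / f\<close>.\<close>
  define E where "E = exp B * (D + D * exp (c * B + norm k))"
  have E: "E > 0" using D by (simp add: E_def add_pos_pos)
  \<comment> \<open>The point \<open>z0\<close> may be a zero of \<open>f\<close>, so the equation
    is divided by \<open>f\<close> only on the surrounding circle, and the maximum principle for
    \<open>h0\<close> returns to the centre. The shift \<open>R1 + 1\<close> keeps the circle where
    the bound for \<open>h1\<close> is valid.\<close>
  have local: "norm (h0 z0) \<le> E * (1 + norm z0) ^ l * exp ((1 + norm z0) powr \<sigma>1)"
    if z0: "norm z0 \<ge> R1 + 1" "Re (poly P0 z0) = 0" for z0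
  proof -
    define t where "t = 1 + norm z0"
    have t: "t \<ge> 1" by (simp add: t_def)
    obtain s where s: "s > 0" "s \<le> 1" "s * t ^ m \<le> D"
      and nb: "\<And>z. norm (z - z0) = s \<Longrightarrow> f z \<noteq> 0 \<and> norm (deriv f z / f z) \<le> D * t ^ l \<and>
       norm (deriv (deriv f) z / f z) \<le> D * t ^ l"
      using circle[of z0] unfolding t_def by blast
    have on_circle: "norm (h0 z) \<le> E * t ^ l * exp (t powr \<sigma>1)" if z: "norm (z - z0) = s" for z
    proof -
      have "norm (poly P0 z - poly P0 z0) \<le> L * t ^ m * s"
        using lip[of z z0] z s(2) by (simp add: t_def)
      also have "\<dots> = L * (s * t ^ m)" by simp
      also have "\<dots> \<le> B" unfolding B_def using L s(3) by (intro mult_left_mono) auto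
      finally have "\<bar>Re (poly P0 z)\<bar> \<le> B"
        using abs_Re_le_cmod[of "poly P0 z - poly P0 z0"] z0(2) by simp
      then have ReP0: "- Re (poly P0 z) \<le> B" "Re (poly P0 z) \<le> B" by auto
      have "Re (poly P1 z) = c * Re (poly P0 z) + Re k" by (simp add: P1)
      also have "\<dots> \<le> c * B + norm k"
        using ReP0(2) assms(10) complex_Re_le_cmod[of k] by (intro add_mono mult_left_mono) auto
      finally have ReP1: "Re (poly P1 z) \<le> c * B + norm k" .
      have nz: "norm z \<ge> R1" "norm z \<le> t"
        using norm_triangle_ineq2[of z z0] norm_triangle_ineq2[of z0 z] z z0(1) s(2)
        by (auto simp: t_def norm_minus_commute)
      have "norm (h1 z) \<le> exp (norm z powr \<sigma>1)" using R1 nz(1) by blast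
      also have "\<dots> \<le> exp (t powr \<sigma>1)" using nz(2) \<sigma>1_pos by (simp add: powr_mono2)
      finally have h1: "norm (h1 z) \<le> exp (t powr \<sigma>1)" .
      have fz: "f z \<noteq> 0" using nb[OF z] by blast
      have "h0 z * exp (poly P0 z) =
          - (deriv (deriv f) z / f z + h1 z * exp (poly P1 z) * (deriv f z / f z))"
        using assms(15)[of z] fz by (simp add: field_simps add_eq_0_iff)
      then have "h0 z = - (deriv (deriv f) z / f z + h1 z * exp (poly P1 z) * (deriv f z / f z)) * exp (- poly P0 z)"
        by (simp add: exp_minus field_simps)
      then have "norm (h0 z) =
          norm (deriv (deriv f) z / f z + h1 z * exp (poly P1 z) * (deriv f z / f z)) * exp (- Re (poly P0 z))"
        by (simp only: norm_mult norm_minus_cancel norm_exp_eq_Re uminus_complex.sel)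
      also have "\<dots> \<le> (norm (deriv (deriv f) z / f z) + norm (h1 z) * exp (Re (poly P1 z)) * norm (deriv f z / f z)) * exp B"
      proof (intro mult_mono)
        show "norm (deriv (deriv f) z / f z + h1 z * exp (poly P1 z) * (deriv f z / f z)) \<le>
          norm (deriv (deriv f) z / f z) + norm (h1 z) * exp (Re (poly P1 z)) * norm (deriv f z / f z)"
          by (metis norm_triangle_ineq norm_mult norm_exp_eq_Re)
      qed (use ReP0 in auto)
      also have "\<dots> \<le> (D * t ^ l * exp (t powr \<sigma>1) + exp (t powr \<sigma>1) * exp (c * B + norm k) * (D * t ^ l)) * exp B"
      proof (intro mult_right_mono add_mono mult_mono)
        have "D * t ^ l * 1 \<le> D * t ^ l * exp (t powr \<sigma>1)"
          using D t by (intro mult_left_mono) auto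
        then show "norm (deriv (deriv f) z / f z) \<le> D * t ^ l * exp (t powr \<sigma>1)"
          using nb[OF z] by linarith
      qed (use nb[OF z] h1 ReP1 in auto)
      also have "\<dots> = E * t ^ l * exp (t powr \<sigma>1)" by (simp add: E_def algebra_simps)
      finally show ?thesis .
    qed
    have "norm (h0 z0) \<le> E * t ^ l * exp (t powr \<sigma>1)"
    proof (rule maximum_modulus_frontier[of h0 "cball z0 s"])
      show "h0 holomorphic_on interior (cball z0 s)"
        by (rule holomorphic_on_subset[OF assms(5)]) auto
      show "continuous_on (closure (cball z0 s)) h0"
        by (rule continuous_on_subset[OF holomorphic_on_imp_continuous_on[OF assms(5)]]) auto
    qed (use s on_circle in \<open>auto simp: dist_norm norm_minus_commute\<close>)
    then show ?thesis by (simp add: t_def)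
  qed
  have "\<forall>\<^sub>F r in at_top. E * (1 + r) ^ l * exp ((1 + r) powr \<sigma>1) \<le> exp (r powr \<sigma>)"
  proof -
    have "\<forall>\<^sub>F r in at_top. ln E + real l * ln (1 + r) + (1 + r) powr \<sigma>1 \<le> r powr \<sigma>"
      using \<sigma>1_pos \<sigma>(1) by real_asymp
    then show ?thesis
      using eventually_gt_at_top[of 0]
    proof eventually_elim
      case (elim r)
      have "E * (1 + r) ^ l * exp ((1 + r) powr \<sigma>1) = exp (ln E + real l * ln (1 + r) + (1 + r) powr \<sigma>1)"
        using E elim by (simp add: exp_add exp_of_nat_mult)
      with elim show ?case by simp
    qed
  qed
  then obtain R3 where R3: "\<And>r. r \<ge> R3 \<Longrightarrow> E * (1 + r) ^ l * exp ((1 + r) powr \<sigma>1) \<le> exp (r powr \<sigma>)"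
    by (auto simp: eventually_at_top_linorder)
  define R0 where "R0 = max (R1 + 1) (max R2 R3)"
  have growth: "norm (h0 z) \<le> exp (norm z powr \<rho>)" if "norm z \<ge> R0" for z
    using R2 that by (simp add: R0_def)
  have critical: "norm (h0 z) \<le> exp (norm z powr \<sigma>)" if "norm z \<ge> R0" "Re (poly P0 z) = 0" for z
    using local[of z] R3[of "norm z"] that by (force simp: R0_def)
  obtain C1 Ra where C1: "\<And>z. norm z \<ge> Ra \<Longrightarrow> Re (poly P0 z) \<ge> 0 \<Longrightarrow> norm (h0 z) \<le> exp (C1 * norm z powr \<sigma>)"
    using Phragmen_Lindelof_poly[OF assms(5,3,1) \<sigma>n \<rho>(2) growth critical] by blast
  \<comment> \<open>Passing to \<open>- P0\<close> keeps the curves and covers the remaining points,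
    those with \<open>Re (poly P0 z) \<le> 0\<close>.\<close>
  obtain C2 Rb where C2: "\<And>z. norm z \<ge> Rb \<Longrightarrow> Re (poly (- P0) z) \<ge> 0 \<Longrightarrow> norm (h0 z) \<le> exp (C2 * norm z powr \<sigma>)"
    using Phragmen_Lindelof_poly[of h0 "- P0" n \<sigma> \<rho> R0] assms(1,3,5) \<sigma>n \<rho>(2) growth critical by auto
  have "\<forall>\<^sub>F r in at_top. max C1 C2 * r powr \<sigma> \<le> r powr \<mu>"
    using \<mu>(1) by real_asymp
  then obtain R4 where R4: "\<And>r. r \<ge> R4 \<Longrightarrow> max C1 C2 * r powr \<sigma> \<le> r powr \<mu>"
    by (auto simp: eventually_at_top_linorder)
  have "entire_lower_order h0 \<le> ereal \<mu>"
  proof (rule entire_lower_order_le)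
    show "\<mu> \<ge> 0" using \<mu>(1) \<sigma>n by simp
    fix z :: complex assume z: "norm z \<ge> max R4 (max Ra Rb)"
    have "norm (h0 z) \<le> exp (max C1 C2 * norm z powr \<sigma>)"
    proof (cases "Re (poly P0 z) \<ge> 0")
      case True
      have "norm (h0 z) \<le> exp (C1 * norm z powr \<sigma>)" using C1 z True by auto
      also have "\<dots> \<le> exp (max C1 C2 * norm z powr \<sigma>)" by (simp add: mult_right_mono)
      finally show ?thesis .
    next
      case False
      have "norm (h0 z) \<le> exp (C2 * norm z powr \<sigma>)" using C2 z False by auto
      also have "\<dots> \<le> exp (max C1 C2 * norm z powr \<sigma>)" by (simp add: mult_right_mono)
      finally show ?thesis .
    qed
    also have "\<dots> \<le> exp (norm z powr \<mu>)" using R4 z by simp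
    finally show "norm (h0 z) \<le> exp (norm z powr \<mu>)" .
  qed
  with \<mu>(2) show False by simp
qed

end
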